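(* Let $Y$ be a real random variable whose moment generating function $E[e^{tY}]$ exists for $|t|<\rho$ for some $\rho>0$, and let $r\ge 0$ be an integer. For every integer $n\ge 0$, $$D_{n+r}^{(r,Y)}=(n+r)!\sum_{l=0}^{n}\binom{r+l-1}{l}\frac{D_{n-l}^{Y}}{(n-l)!}.$$
   Context: For an integer $r\ge 0$, the probabilistic $r$-derangement numbers $D_n^{(r,Y)}$ ($n\ge r$) associated with $Y$ are defined by the generating function (for $t$ near $0$) $$\frac{t^{r}}{(1-t)^{r+1}}E\big[e^{-Yt}\big]=\sum_{n=r}^{\infty}D_{n}^{(r,Y)}\frac{t^{n}}{n!}.$$ The probabilistic derangement numbers $D_n^Y$ associated with $Y$ are defined by $$\frac{1}{1-t}E\big[e^{-tY}\big]=\sum_{n=0}^{\infty}D_{n}^{Y}\frac{t^{n}}{n!}.$$ The binomial coefficient is $\binom{a}{l}=\frac{a(a-1)\cdots(a-l+1)}{l!}$ for any integer $a$ and $l\ge 0$ (so $\binom{-1}{0}=1$). *)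

theory Defs
  imports "HOL-Probability.Probability"
begin

definition has_mgf_near_0 :: "'a measure \<Rightarrow> ('a \<Rightarrow> real) \<Rightarrow> real \<Rightarrow> bool" where
  "has_mgf_near_0 M Y \<rho> \<longleftrightarrow>
     \<rho> > 0 \<and> (\<forall>t. \<bar>t\<bar> < \<rho> \<longrightarrow> integrable M (\<lambda>\<omega>. exp (t * Y \<omega>)))"

text \<open>The numbers are determined by their exponential generating function, an identity of
  convergent power series for all real t in some neighbourhood of 0. The definite description is
  well defined as soon as the moment generating function of Y exists near 0.\<close>

definition prob_derangement :: "'a measure \<Rightarrow> ('a \<Rightarrow> real) \<Rightarrow> nat \<Rightarrow> real" where
  "prob_derangement M Y =
     (THE D. \<forall>\<^sub>F t in nhds (0::real).
        (\<lambda>n. D n * (t ^ n / fact n)) sums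
          (1 / (1 - t) * (\<integral>\<omega>. exp (- t * Y \<omega>) \<partial>M)))"

text \<open>The r-derangement numbers are indexed by n \<open>\<ge>\<close> r, so the series starts at n = r
  (below, n = k + r). The irrelevant values at n < r are set to 0 to make the description unique.\<close>

definition prob_r_derangement :: "nat \<Rightarrow> 'a measure \<Rightarrow> ('a \<Rightarrow> real) \<Rightarrow> nat \<Rightarrow> real" where
  "prob_r_derangement r M Y =
     (THE D. (\<forall>n<r. D n = 0) \<and>
       (\<forall>\<^sub>F t in nhds (0::real).
          (\<lambda>k. D (k + r) * (t ^ (k + r) / fact (k + r))) sums
            (t ^ r / (1 - t) ^ (r + 1) * (\<integral>\<omega>. exp (- Y \<omega> * t) \<partial>M))))"

end

theory Submission
  imports Defs
begin

text \<open>
  Write \<open>G(t) = E[exp (- t * Y)]\<close>. Since \<open>t^r / (1 - t)^(r + 1) = t^r * (1 - t)^(-r) * 1 / (1 - t)\<close>,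
  the generating function of the \<open>r\<close>-derangement numbers is \<open>t^r * (1 - t)^(-r)\<close> times that of the
  derangement numbers. The coefficient of \<open>t^l\<close> in \<open>(1 - t)^(-r)\<close> is
  \<open>(-1)^l * ((-r) gchoose l) = (r + l - 1) gchoose l\<close>, and comparing the coefficients of
  \<open>t^(n + r)\<close> gives a Cauchy product, which is the claim.

  Both families of numbers are given by definite descriptions, so this comparison needs two
  analytic facts. First, \<open>G\<close> is the sum of a power series near \<open>0\<close>
  (\<open>has_fps_expansion_mgf\<close>); the products above are then products of formal power series.
  Second, over the reals a function has at most one power series at \<open>0\<close>
  (\<open>powser_coeff_eq_0\<close>), so the described sequences can be read off from any such expansion
  (\<open>the_egf_coeffs\<close>).
\<close>

text \<open>The limit of the sum at \<open>0\<close> is the constant coefficient. The induction then divides the series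
  by \<open>t\<close>, which is only possible off \<open>0\<close>; hence the filter \<open>at 0\<close> rather than \<open>nhds 0\<close>.\<close>

lemma powser_coeff_eq_0:
  fixes c :: "nat \<Rightarrow> real"
  assumes "\<forall>\<^sub>F t in at 0. (\<lambda>n. c n * t ^ n) sums 0"
  shows "c n = 0"
  using assms
proof (induction n arbitrary: c)
  have head: "c 0 = 0" if c: "\<forall>\<^sub>F t in at 0. (\<lambda>n. c n * t ^ n) sums 0" for c :: "nat \<Rightarrow> real"
  proof -
    obtain s where "s > 0" and s: "\<And>t. t \<noteq> 0 \<Longrightarrow> norm t < s \<Longrightarrow> (\<lambda>n. c n * t ^ n) sums 0"
      using c by (auto simp: eventually_at dist_norm)
    have "((\<lambda>t::real. 0) \<longlongrightarrow> c 0) (at 0)"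
      using powser_limit_0_strong[of s c "\<lambda>_. 0"] \<open>s > 0\<close> s by simp
    then show ?thesis
      using tendsto_unique[OF _ tendsto_const] trivial_limit_at by metis
  qed
  case 0
  then show ?case by (rule head)
  case (Suc n)
  have "\<forall>\<^sub>F t in at 0. (\<lambda>n. c (Suc n) * t ^ n) sums 0"
    using Suc.prems eventually_neq_at_within[of 0]
  proof eventually_elim
    case (elim t)
    then have "(\<lambda>n. c (Suc n) * t ^ Suc n) sums 0"
      using head[OF Suc.prems] sums_Suc_iff[of "\<lambda>n. c n * t ^ n" 0] by simp
    then have "(\<lambda>n. inverse t * (c (Suc n) * t ^ Suc n)) sums (inverse t * 0)"
      by (rule sums_mult)
    then show ?case using elim(2) by (simp add: field_simps)
  qed
  then show ?case by (rule Suc.IH)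
qed

lemma has_fps_expansion_iff_sums:
  fixes f :: "real \<Rightarrow> real"
  shows "f has_fps_expansion F \<longleftrightarrow> (\<forall>\<^sub>F t in nhds 0. (\<lambda>n. fps_nth F n * t ^ n) sums f t)"
proof
  assume F: "f has_fps_expansion F"
  then have "\<forall>\<^sub>F t in nhds 0. t \<in> eball 0 (fps_conv_radius F)"
    by (intro eventually_nhds_in_open) (auto simp: has_fps_expansion_def zero_ereal_def)
  moreover have "\<forall>\<^sub>F t in nhds 0. eval_fps F t = f t"
    using F by (simp add: has_fps_expansion_def)
  ultimately show "\<forall>\<^sub>F t in nhds 0. (\<lambda>n. fps_nth F n * t ^ n) sums f t"
  proof eventually_elim
    case (elim t)
    then show ?case using sums_eval_fps[of t F] by simp
  qed
next
  assume F: "\<forall>\<^sub>F t in nhds 0. (\<lambda>n. fps_nth F n * t ^ n) sums f t"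
  then obtain s where "s > 0" and s: "\<And>t. dist t 0 < s \<Longrightarrow> (\<lambda>n. fps_nth F n * t ^ n) sums f t"
    by (auto simp: eventually_nhds_metric)
  have "ereal (norm (s / 2)) \<le> fps_conv_radius F"
    unfolding fps_conv_radius_def
    using s[of "s / 2"] \<open>s > 0\<close> by (intro conv_radius_geI sums_summable) simp
  then have "fps_conv_radius F > 0"
    using \<open>s > 0\<close> less_le_trans[of 0 "ereal (norm (s / 2))"] by (simp add: zero_ereal_def)
  moreover have "\<forall>\<^sub>F t in nhds 0. eval_fps F t = f t"
    using F by eventually_elim (simp add: eval_fps_def sums_iff)
  ultimately show "f has_fps_expansion F" by (simp add: has_fps_expansion_def)
qed

lemma has_fps_expansion_real_unique:
  fixes f :: "real \<Rightarrow> real"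
  assumes "f has_fps_expansion F" and "f has_fps_expansion G"
  shows "F = G"
proof (rule fps_ext)
  fix n
  have "(\<lambda>t. f t - f t) has_fps_expansion F - G"
    using assms by (rule has_fps_expansion_diff)
  then have "\<forall>\<^sub>F t in at 0. (\<lambda>n. fps_nth (F - G) n * t ^ n) sums 0"
    unfolding has_fps_expansion_iff_sums by (simp add: eventually_nhds_conv_at)
  then have "fps_nth (F - G) n = 0" by (rule powser_coeff_eq_0)
  then show "fps_nth F n = fps_nth G n" by simp
qed

text \<open>This evaluates both definite descriptions: the case \<open>r = 0\<close> is the one of the ordinary
  derangement numbers.\<close>

lemma the_egf_coeffs:
  fixes f :: "real \<Rightarrow> real"
  assumes F: "f has_fps_expansion F" and low: "\<And>n. n < r \<Longrightarrow> fps_nth F n = 0"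
  shows "(THE D. (\<forall>n<r. D n = 0) \<and>
           (\<forall>\<^sub>F t in nhds 0. (\<lambda>k. D (k + r) * (t ^ (k + r) / fact (k + r))) sums f t))
         = (\<lambda>n. fact n * fps_nth F n)"
proof -
  \<comment> \<open>As the terms below \<open>r\<close> vanish, the series may as well start at \<open>0\<close>.\<close>
  have shift: "(\<forall>\<^sub>F t in nhds 0. (\<lambda>k. D (k + r) * (t ^ (k + r) / fact (k + r))) sums f t)
      \<longleftrightarrow> f has_fps_expansion Abs_fps (\<lambda>n. D n / fact n)"
    if "\<forall>n<r. D n = 0" for D :: "nat \<Rightarrow> real"
  proof -
    have "(\<lambda>k. D (k + r) * (t ^ (k + r) / fact (k + r))) sums f t
        \<longleftrightarrow> (\<lambda>n. D n / fact n * t ^ n) sums f t" for t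
      using sums_zero_iff_shift[of r "\<lambda>n. D n / fact n * t ^ n" "f t"] that by simp
    then show ?thesis by (simp add: has_fps_expansion_iff_sums)
  qed
  show ?thesis
  proof (rule the_equality, intro conjI)
    show D0: "\<forall>n<r. fact n * fps_nth F n = 0" using low by simp
    show "\<forall>\<^sub>F t in nhds 0. (\<lambda>k. fact (k + r) * fps_nth F (k + r) * (t ^ (k + r) / fact (k + r)))
            sums f t"
      using shift[OF D0] F by (simp add: has_fps_expansion_iff_sums)
  next
    fix D :: "nat \<Rightarrow> real"
    assume D: "(\<forall>n<r. D n = 0) \<and>
      (\<forall>\<^sub>F t in nhds 0. (\<lambda>k. D (k + r) * (t ^ (k + r) / fact (k + r))) sums f t)"
    then have "f has_fps_expansion Abs_fps (\<lambda>n. D n / fact n)" using shift by blast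
    then have "F = Abs_fps (\<lambda>n. D n / fact n)" using F has_fps_expansion_real_unique by blast
    then show "D = (\<lambda>n. fact n * fps_nth F n)" by (simp add: fun_eq_iff)
  qed
qed

text \<open>The exponential series is integrated term by term. This is dominated convergence: all its
  partial sums at \<open>- t * Y\<close> are bounded by
  \<open>exp \<bar>t * Y\<bar> \<le> exp (t * Y) + exp (- t * Y)\<close>.\<close>

lemma has_fps_expansion_mgf:
  assumes meas: "Y \<in> borel_measurable M" and mgf: "has_mgf_near_0 M Y \<rho>"
  shows "(\<lambda>t. \<integral>\<omega>. exp (- t * Y \<omega>) \<partial>M) has_fps_expansion
           Abs_fps (\<lambda>n. \<integral>\<omega>. (- Y \<omega>) ^ n / fact n \<partial>M)"
proof -
  have sums: "(\<lambda>n. (\<integral>\<omega>. (- Y \<omega>) ^ n / fact n \<partial>M) * t ^ n) sums (\<integral>\<omega>. exp (- t * Y \<omega>) \<partial>M)"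
    if t: "\<bar>t\<bar> < \<rho>" for t
  proof -
    define a where "a n \<omega> = (- t * Y \<omega>) ^ n / fact n" for n \<omega>
    define w where "w \<omega> = exp (t * Y \<omega>) + exp (- t * Y \<omega>)" for \<omega>
    have [measurable]: "a n \<in> borel_measurable M" for n
      unfolding a_def using meas by measurable
    have w: "integrable M w"
      unfolding w_def using mgf t
      by (intro Bochner_Integration.integrable_add) (simp_all only: has_mgf_near_0_def abs_minus_cancel)
    have exp_sums: "(\<lambda>n. x ^ n / fact n) sums exp x" for x :: real
      using exp_converges[of x] by (simp add: field_simps)
    have bound: "(\<Sum>n\<in>A. \<bar>a n \<omega>\<bar>) \<le> w \<omega>" if "finite A" for A \<omega>
    proof -
      have "(\<lambda>n. \<bar>a n \<omega>\<bar>) sums exp \<bar>t * Y \<omega>\<bar>"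
        using exp_sums[of "\<bar>t * Y \<omega>\<bar>"] by (simp add: a_def power_abs)
      then have "(\<Sum>n\<in>A. \<bar>a n \<omega>\<bar>) \<le> exp \<bar>t * Y \<omega>\<bar>"
        using sum_le_suminf[OF _ that, of "\<lambda>n. \<bar>a n \<omega>\<bar>"] by (simp add: sums_iff)
      also have "\<dots> \<le> w \<omega>" by (simp add: w_def abs_if)
      finally show ?thesis .
    qed
    have int: "integrable M (a n)" for n
    proof (rule Bochner_Integration.integrable_bound[OF w])
      show "AE \<omega> in M. norm (a n \<omega>) \<le> norm (w \<omega>)"
        using bound[of "{n}"] by (auto intro!: AE_I2 order_trans[OF _ abs_ge_self])
    qed simp
    have "(\<lambda>N. \<integral>\<omega>. (\<Sum>n<N. a n \<omega>) \<partial>M) \<longlonglongrightarrow> (\<integral>\<omega>. exp (- t * Y \<omega>) \<partial>M)"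
    proof (rule integral_dominated_convergence[OF _ _ w])
      show "AE \<omega> in M. (\<lambda>N. \<Sum>n<N. a n \<omega>) \<longlonglongrightarrow> exp (- t * Y \<omega>)"
        using exp_sums by (auto simp: a_def sums_def)
      show "AE \<omega> in M. norm (\<Sum>n<N. a n \<omega>) \<le> w \<omega>" for N
        using bound[of "{..<N}"] by (auto intro!: AE_I2 order_trans[OF sum_abs])
    qed (use meas in measurable)
    then have "(\<lambda>n. \<integral>\<omega>. a n \<omega> \<partial>M) sums (\<integral>\<omega>. exp (- t * Y \<omega>) \<partial>M)"
      by (simp add: sums_def Bochner_Integration.integral_sum int)
    moreover have "(\<integral>\<omega>. a n \<omega> \<partial>M) = (\<integral>\<omega>. (- Y \<omega>) ^ n / fact n \<partial>M) * t ^ n" for n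
    proof -
      have "a n = (\<lambda>\<omega>. (- Y \<omega>) ^ n / fact n * t ^ n)"
        by (simp add: a_def fun_eq_iff mult.commute flip: power_mult_distrib)
      then show ?thesis by (simp only: integral_mult_left_zero)
    qed
    ultimately show ?thesis by simp
  qed
  have "\<rho> > 0" using mgf by (simp add: has_mgf_near_0_def)
  then have "\<forall>\<^sub>F t in nhds 0. \<bar>t\<bar> < \<rho>"
    by (auto simp: eventually_nhds_metric dist_real_def)
  then show ?thesis
    unfolding has_fps_expansion_iff_sums
    by eventually_elim (use sums in simp)
qed

text \<open>This is the negative binomial series. The generalised binomial coefficient keeps the formula valid
  for \<open>r = 0\<close>, where the value at \<open>l = 0\<close> is \<open>(- 1) gchoose 0 = 1\<close> and all others vanish.\<close>

lemma fps_nth_inverse_one_minus_X_power: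
  "fps_nth (inverse ((1 - fps_X) ^ r) :: real fps) l = (real r + real l - 1) gchoose l"
proof -
  have "- fps_const (1 :: real) * fps_X = fps_const (- 1) * fps_X"
    by (simp only: fps_const_neg)
  then have "inverse ((1 - fps_X) ^ r)
      = fps_compose (fps_binomial (- real r)) (fps_const (- 1) * fps_X)"
    using one_minus_fps_X_const_neg_power[of "1 :: real" r]
    by (simp only: fps_const_1_eq_1 mult_1_left)
  then show ?thesis
    by (simp only: fps_compose_linear) (simp add: gbinomial_minus flip: mult.assoc power_mult_distrib)
qed

theorem theorem2p8:
  fixes M :: "'a measure" and Y :: "'a \<Rightarrow> real" and \<rho> :: real and r n :: nat
  assumes "prob_space M"
    and "Y \<in> borel_measurable M"
    and "has_mgf_near_0 M Y \<rho>"
  shows "prob_r_derangement r M Y (n + r) =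
    fact (n + r) * (\<Sum>l = 0..n. ((real r + real l - 1) gchoose l) *
                       (prob_derangement M Y (n - l) / fact (n - l)))"
proof -
  define G where "G t = (\<integral>\<omega>. exp (- t * Y \<omega>) \<partial>M)" for t
  obtain F where F: "G has_fps_expansion F"
    using has_fps_expansion_mgf[OF assms(2,3)] unfolding G_def by blast
  define H where "H = inverse (1 - fps_X) * F"
  have H: "(\<lambda>t. inverse (1 - t) * G t) has_fps_expansion H"
    unfolding H_def by (intro fps_expansion_intros F) auto
  define R where "R = fps_X ^ r * (inverse ((1 - fps_X) ^ r) * H)"
  have pow: "(\<lambda>t::real. (1 - t) ^ r) has_fps_expansion (1 - fps_X) ^ r"
    using has_fps_expansion_prod[of "{..<r}" "\<lambda>_ t. 1 - t" "\<lambda>_. 1 - fps_X :: real fps"]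
    by (simp add: fps_expansion_intros)
  have "(\<lambda>t. t ^ r * (inverse ((1 - t) ^ r) * (inverse (1 - t) * G t))) has_fps_expansion R"
    unfolding R_def by (intro fps_expansion_intros H pow) simp
  then have R: "(\<lambda>t. t ^ r / (1 - t) ^ (r + 1) * G t) has_fps_expansion R"
    by (simp add: field_simps)
  have D: "prob_derangement M Y = (\<lambda>n. fact n * fps_nth H n)"
    using the_egf_coeffs[OF H, of 0]
    by (simp add: prob_derangement_def G_def inverse_eq_divide)
  have "prob_r_derangement r M Y = (\<lambda>n. fact n * fps_nth R n)"
    using the_egf_coeffs[OF R, of r]
    by (simp add: prob_r_derangement_def G_def R_def fps_X_power_mult_nth mult.commute)
  then have "prob_r_derangement r M Y (n + r) = fact (n + r) * fps_nth R (n + r)" by simp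
  also have "fps_nth R (n + r) = (\<Sum>l = 0..n. ((real r + real l - 1) gchoose l) * fps_nth H (n - l))"
    by (simp add: R_def fps_X_power_mult_nth fps_mult_nth[of "inverse _"]
        fps_nth_inverse_one_minus_X_power)
  finally show ?thesis by (simp add: D)
qed

end
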